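(* Let $G=(V,E)$ be a locally finite, simple, undirected, connected graph, let $\Omega$ be a finite subgraph of $G$, and let $l$ be a positive integer. Let $\lambda_k^l$ and $\lambda_k^{2l}$ be the $k$-th eigenvalues of the Dirichlet poly-Laplace operators $(-1)^l\Delta_\Omega^{l,\mathcal D}$ and $\Delta_\Omega^{2l,\mathcal D}$ respectively. Then for all $1\leqslant k\leqslant|\Omega|$, $$\big(\lambda_k^l\big)^2\leqslant\lambda_k^{2l}.$$ Moreover, if $\Omega$ is a finite subgraph of $\mathbb{Z}^d$ (that is, $G=\mathbb{Z}^d$, $d\geqslant1$), then for all $1\leqslant k\leqslant|\Omega|$, $$\big(\lambda_k^l\big)^2<\lambda_k^{2l}.$$
   Context: The graph Laplacian of $f:V\to\mathbb{C}$ is $\Delta f(x)=\sum_{y\sim x}(f(y)-f(x))$, where $y\sim x$ means $x,y$ are joined by an edge of $G$; $\Delta^l$ is its $l$-fold iterate. A finite subgraph $\Omega$ is identified with its vertex set and $|\Omega|$ is its number of vertices. For $f:\Omega\to\mathbb{C}$, let $f^*:V\to\mathbb{C}$ be its extension by zero. The Dirichlet poly-Laplace operator is $\Delta_\Omega^{l,\mathcal D}f=(\Delta^lf^* )|_\Omega$. The operator $(-1)^l\Delta_\Omega^{l,\mathcal D}$ is self-adjoint with respect to the standard Hermitian product on $\mathbb{C}^\Omega$; its real eigenvalues, counted with multiplicity and listed in nondecreasing order, are $\lambda_1^l\leqslant\dots\leqslant\lambda_{|\Omega|}^l$ (superscripts $l$ and $2l$ are indices indicating the order of the operator, not powers). $\mathbb{Z}^d$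 is regarded as a graph with $x\sim y$ iff $x-y\in\{\pm e_1,\dots,\pm e_d\}$. *)

theory Defs
  imports
    "HOL-Analysis.Finite_Cartesian_Product"
    "HOL-Library.Function_Algebras"
    "Graph_Theory.Graph_Theory"
begin

text \<open>
  A simple undirected graph, possibly infinite, is a \<^locale>\<open>pair_bidirected_digraph\<close>: its arcs form
  a symmetric, irreflexive relation on its vertices, an edge being a pair of opposite arcs.
\<close>

definition locally_finite :: "'a pair_pre_digraph \<Rightarrow> bool" where
  "locally_finite G \<longleftrightarrow> (\<forall>x\<in>pverts G. finite {y. (x, y) \<in> parcs G})"

definition lattice_graph :: "(int ^ 'd) pair_pre_digraph" where
  "lattice_graph = \<lparr>pverts = UNIV, parcs = {(x, y). \<exists>i. x - y = axis i 1 \<or> x - y = - axis i 1}\<rparr>"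

definition laplacian :: "'a pair_pre_digraph \<Rightarrow> ('a \<Rightarrow> complex) \<Rightarrow> 'a \<Rightarrow> complex" where
  "laplacian G f x = (\<Sum>y | (x, y) \<in> parcs G. f y - f x)"

definition zero_extension :: "'a set \<Rightarrow> ('a \<Rightarrow> complex) \<Rightarrow> 'a \<Rightarrow> complex" where
  "zero_extension \<Omega> f = (\<lambda>x. if x \<in> \<Omega> then f x else 0)"

text \<open>
  A function on \<open>\<Omega>\<close> is represented by a function on the whole type; only its values on \<open>\<Omega>\<close> matter
  for the operator below, and only the values of the result on \<open>\<Omega>\<close> are meaningful.
\<close>

definition dirichlet_poly_laplace ::
    "'a pair_pre_digraph \<Rightarrow> 'a set \<Rightarrow> nat \<Rightarrow> ('a \<Rightarrow> complex) \<Rightarrow> 'a \<Rightarrow> complex" where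
  "dirichlet_poly_laplace G \<Omega> l f = (laplacian G ^^ l) (zero_extension \<Omega> f)"

global_interpretation cfun: vector_space "\<lambda>(c :: complex) (f :: 'a \<Rightarrow> complex) x. c * f x"
  by unfold_locales (simp_all add: fun_eq_iff algebra_simps)

text \<open>
  In the eigenspaces, the elements of \<open>\<complex>\<^sup>\<Omega>\<close> are normalized to vanish outside \<open>\<Omega>\<close>, so that the
  eigenspace is a copy of the one in \<open>\<complex>\<^sup>\<Omega>\<close> and has the same dimension over \<open>\<complex>\<close>.
\<close>

definition eigenspace_on ::
    "'a set \<Rightarrow> (('a \<Rightarrow> complex) \<Rightarrow> 'a \<Rightarrow> complex) \<Rightarrow> real \<Rightarrow> ('a \<Rightarrow> complex) set" where
  "eigenspace_on \<Omega> T \<mu> =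
     {f. (\<forall>x. x \<notin> \<Omega> \<longrightarrow> f x = 0) \<and> (\<forall>x\<in>\<Omega>. T f x = complex_of_real \<mu> * f x)}"

text \<open>
  The list is well defined for a linear \<open>T\<close> and finite \<open>\<Omega>\<close>; if \<open>T\<close> is moreover self-adjoint on
  \<open>\<complex>\<^sup>\<Omega>\<close>, all its eigenvalues are real and the list has length \<open>|\<Omega>|\<close>.
\<close>

definition real_eigenvalues_on ::
    "'a set \<Rightarrow> (('a \<Rightarrow> complex) \<Rightarrow> 'a \<Rightarrow> complex) \<Rightarrow> real list" where
  "real_eigenvalues_on \<Omega> T =
     (THE xs. sorted xs \<and> (\<forall>\<mu>. count_list xs \<mu> = cfun.dim (eigenspace_on \<Omega> T \<mu>)))"

text \<open>
  The \<open>k\<close>-th eigenvalue of \<open>(-1)\<^sup>l\<close> times the Dirichlet poly-Laplace operator of order \<open>l\<close>, for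
  \<open>1 \<le> k \<le> |\<Omega>|\<close>; the shift is due to list positions starting at 0.
\<close>

definition dirichlet_eigenvalue :: "'a pair_pre_digraph \<Rightarrow> 'a set \<Rightarrow> nat \<Rightarrow> nat \<Rightarrow> real" where
  "dirichlet_eigenvalue G \<Omega> l k =
     real_eigenvalues_on \<Omega> (\<lambda>f x. (-1) ^ l * dirichlet_poly_laplace G \<Omega> l f x) ! (k - 1)"

end

theory Submission
  imports Defs
    "HOL-Library.Groups_Big_Fun"
    "HOL-Computational_Algebra.Fundamental_Theorem_Algebra"
begin

text \<open>
  Let \<open>A = (-1)\<^sup>l \<Delta>\<^sup>l\<close>, a symmetric operator on finitely supported functions, and let \<open>P\<close> be the restriction
  to \<open>\<Omega>\<close>. The operator of order \<open>l\<close> is the compression \<open>B = P A P\<close>, the one of order \<open>2l\<close> is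
  \<open>C = P A\<^sup>2 P\<close>. For \<open>f\<close> supported on \<open>\<Omega>\<close>,
  \<open>\<langle>C f, f\<rangle> = \<parallel>A f\<parallel>\<^sup>2 \<ge> \<parallel>P A f\<parallel>\<^sup>2 = \<parallel>B f\<parallel>\<^sup>2\<close>, since a restriction can only lose mass
  (\<open>dirichlet_operator_compression\<close>). Hence \<open>C \<ge> B\<^sup>2\<close> as quadratic forms. Moreover \<open>B \<ge> 0\<close>
  (\<open>laplacian_power_nonneg\<close>), so the \<open>k\<close>-th eigenvalue of \<open>B\<^sup>2\<close> is the square of the \<open>k\<close>-th
  eigenvalue of \<open>B\<close>, and the min-max principle gives the weak inequality.

  For the comparison itself (\<open>eigenvalue_square_comparison\<close>), a dimension count yields some \<open>f \<noteq> 0\<close> that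
  lies in the span of the first \<open>k\<close> eigenvectors of \<open>C\<close> and is orthogonal to the first \<open>k - 1\<close>
  eigenvectors of \<open>B\<close>. On it
  \<open>(\<lambda>\<^sub>k(B))\<^sup>2 \<parallel>f\<parallel>\<^sup>2 \<le> \<parallel>B f\<parallel>\<^sup>2 \<le> \<langle>C f, f\<rangle> \<le> \<lambda>\<^sub>k(C) \<parallel>f\<parallel>\<^sup>2\<close>. Equality throughout forces \<open>f\<close> to be
  an eigenvector of \<open>B\<close> and \<open>A f\<close> to be supported on \<open>\<Omega>\<close>, so that \<open>A f = \<lambda>\<^sub>k(B) f\<close> on the whole graph.
  In \<open>\<int>\<^sup>d\<close> this is impossible: \<open>l\<close> applications of \<open>\<Delta>\<close> push the support of \<open>f\<close> exactly \<open>l\<close> steps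
  further in each coordinate direction (\<open>lattice_laplacian_front\<close>), so \<open>A f\<close> is nonzero at some
  zero of \<open>f\<close>.

  The spectral theorem for self-adjoint operators on \<open>\<complex>\<^sup>\<Omega>\<close>, needed to identify the list of
  eigenvalues with an orthonormal eigenbasis, is proved along the way. All dimension counts are
  instances of \<open>homogeneous_system_nontrivial\<close>.
\<close>

section \<open>Finitely supported functions and the Hermitian product\<close>

text \<open>
  Gaussian elimination: an unknown with a nonzero coefficient in one equation is solved for and
  eliminated from the other equations.
\<close>

lemma homogeneous_system_nontrivial:
  fixes M :: "'i \<Rightarrow> 'j \<Rightarrow> 'k::field"
  assumes "finite J" "finite I" "card J < card I"
  shows "\<exists>c. (\<exists>i\<in>I. c i \<noteq> 0) \<and> (\<forall>j\<in>J. (\<Sum>i\<in>I. c i * M i j) = 0)"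
  using assms
proof (induction J arbitrary: I M rule: finite_induct)
  case empty
  then have "I \<noteq> {}" by auto
  then show ?case by (intro exI[of _ "\<lambda>_. 1"]) auto
next
  case (insert j J)
  show ?case
  proof (cases "\<forall>i\<in>I. M i j = 0")
    case True
    have "\<exists>c. (\<exists>i\<in>I. c i \<noteq> 0) \<and> (\<forall>j\<in>J. (\<Sum>i\<in>I. c i * M i j) = 0)"
      using insert by (intro insert.IH) auto
    with True show ?thesis by (auto intro!: exI sum.neutral)
  next
    case False
    then obtain p where p: "p \<in> I" "M p j \<noteq> 0" by blast
    define I' where "I' = I - {p}"
    have I: "I = insert p I'" "p \<notin> I'" "finite I'"
      using p insert.prems by (auto simp: I'_def)
    have "\<exists>c. (\<exists>i\<in>I'. c i \<noteq> 0) \<and>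
        (\<forall>q\<in>J. (\<Sum>i\<in>I'. c i * (M i q - M i j / M p j * M p q)) = 0)"
      using insert I by (intro insert.IH) auto
    then obtain c where c: "\<exists>i\<in>I'. c i \<noteq> 0"
      "\<And>q. q \<in> J \<Longrightarrow> (\<Sum>i\<in>I'. c i * (M i q - M i j / M p j * M p q)) = 0"
      by blast
    define s where "s = (\<Sum>i\<in>I'. c i * M i j / M p j)"
    define c' where "c' = c(p := - s)"
    have sum_c': "(\<Sum>i\<in>I. c' i * M i q) = (\<Sum>i\<in>I'. c i * M i q) - s * M p q" for q
    proof -
      have "(\<Sum>i\<in>I'. c' i * M i q) = (\<Sum>i\<in>I'. c i * M i q)"
        using I by (intro sum.cong) (auto simp: c'_def)
      then show ?thesis using I by (simp add: c'_def)
    qed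
    have "(\<Sum>i\<in>I. c' i * M i j) = 0"
      using p unfolding sum_c' s_def by (simp add: sum_distrib_right)
    moreover have "(\<Sum>i\<in>I. c' i * M i q) = 0" if "q \<in> J" for q
      using c(2)[OF that] unfolding sum_c' s_def
      by (simp add: sum_distrib_right sum_distrib_left sum_subtractf algebra_simps)
    moreover have "\<exists>i\<in>I. c' i \<noteq> 0"
      using c(1) I by (auto simp: c'_def)
    ultimately show ?thesis by blast
  qed
qed

lemma sum_fun_apply: "(\<Sum>i\<in>I. F i) x = (\<Sum>i\<in>I. F i x)"
  for F :: "'i \<Rightarrow> 'a \<Rightarrow> 'b::comm_monoid_add"
  by (induction I rule: infinite_finite_induct) auto

definition supported_on :: "'a set \<Rightarrow> ('a \<Rightarrow> complex) \<Rightarrow> bool" where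
  "supported_on D f \<longleftrightarrow> (\<forall>x. x \<notin> D \<longrightarrow> f x = 0)"

lemma supported_on_zero_extension [simp]: "supported_on D (zero_extension D f)"
  by (simp add: supported_on_def zero_extension_def)

lemma zero_extension_supported: "supported_on D f \<Longrightarrow> zero_extension D f = f"
  by (auto simp: supported_on_def zero_extension_def)

lemma supported_on_scale: "supported_on D f \<Longrightarrow> supported_on D (\<lambda>x. c * f x)"
  by (simp add: supported_on_def)

lemma supported_on_diff:
  "supported_on D f \<Longrightarrow> supported_on D g \<Longrightarrow> supported_on D (\<lambda>x. f x - g x)"
  by (simp add: supported_on_def)

lemma supported_on_sum:
  "(\<And>i. i \<in> I \<Longrightarrow> supported_on D (v i)) \<Longrightarrow> supported_on D (\<lambda>x. \<Sum>i\<in>I. c i * v i x)"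
  by (simp add: supported_on_def)

text \<open>
  The product sums over the whole type and not over \<open>\<Omega>\<close>, because powers of the Laplacian do not
  preserve the functions supported on a given finite set. An infinite sum is 0 by convention, so
  the laws below ask for one factor of finite support.
\<close>

definition l2_inner :: "('a \<Rightarrow> complex) \<Rightarrow> ('a \<Rightarrow> complex) \<Rightarrow> complex" where
  "l2_inner f g = Sum_any (\<lambda>x. f x * cnj (g x))"

lemma l2_inner_left:
  "finite D \<Longrightarrow> supported_on D f \<Longrightarrow> l2_inner f g = (\<Sum>x\<in>D. f x * cnj (g x))"
  unfolding l2_inner_def supported_on_def
  by (rule Sum_any.expand_superset) auto

lemma l2_inner_right:
  "finite D \<Longrightarrow> supported_on D g \<Longrightarrow> l2_inner f g = (\<Sum>x\<in>D. f x * cnj (g x))"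
  unfolding l2_inner_def supported_on_def
  by (rule Sum_any.expand_superset) auto

lemma l2_inner_cnj:
  assumes "finite D" "supported_on D f"
  shows "l2_inner g f = cnj (l2_inner f g)"
  by (simp add: l2_inner_left[OF assms] l2_inner_right[OF assms] mult.commute)

lemma l2_inner_scale_left:
  assumes "finite D" "supported_on D g"
  shows "l2_inner (\<lambda>x. c * f x) g = c * l2_inner f g"
  by (simp add: l2_inner_right[OF assms] sum_distrib_left mult.assoc)

lemma l2_inner_scale_right:
  assumes "finite D" "supported_on D f"
  shows "l2_inner f (\<lambda>x. c * g x) = cnj c * l2_inner f g"
  by (simp add: l2_inner_left[OF assms] sum_distrib_left mult.left_commute)

lemma l2_inner_diff_left:
  assumes "finite D" "supported_on D h"
  shows "l2_inner (\<lambda>x. f x - g x) h = l2_inner f h - l2_inner g h"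
  by (simp add: l2_inner_right[OF assms] algebra_simps sum_subtractf)

lemma l2_inner_sum_left:
  assumes "finite D" "supported_on D g"
  shows "l2_inner (\<lambda>x. \<Sum>i\<in>I. c i * v i x) g = (\<Sum>i\<in>I. c i * l2_inner (v i) g)"
  unfolding l2_inner_right[OF assms] sum_distrib_right sum_distrib_left
  by (subst sum.swap) (simp add: mult.assoc)

lemma l2_inner_self:
  assumes "finite D" "supported_on D f"
  shows "l2_inner f f = of_real (\<Sum>x\<in>D. (cmod (f x))\<^sup>2)"
  unfolding l2_inner_left[OF assms] of_real_sum complex_norm_square ..

lemma l2_inner_self_real:
  assumes "finite D" "supported_on D f"
  shows "l2_inner f f = of_real (Re (l2_inner f f))"
  by (simp add: l2_inner_self[OF assms])

lemma l2_inner_self_nonneg: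
  assumes "finite D" "supported_on D f"
  shows "0 \<le> Re (l2_inner f f)"
  by (simp add: l2_inner_self[OF assms] sum_nonneg)

lemma l2_inner_self_pos:
  assumes "finite D" "supported_on D f" "f \<noteq> (\<lambda>x. 0)"
  shows "0 < Re (l2_inner f f)"
proof -
  from assms(3) obtain x where "f x \<noteq> 0" by auto
  with assms(2) have "x \<in> D" by (auto simp: supported_on_def)
  then show ?thesis
    using \<open>f x \<noteq> 0\<close> assms(1) by (auto simp: l2_inner_self[OF assms(1,2)] intro!: sum_pos2)
qed

text \<open>
  If the remainder of the expansion of \<open>f\<close> were nonzero, it could be added to the family, giving
  \<open>card D + 1\<close> orthogonal nonzero functions on \<open>card D\<close> points.
\<close>

lemma orthonormal_family_complete:
  assumes D: "finite D" and v: "\<And>i. i < card D \<Longrightarrow> supported_on D (v i)"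
    and orth: "\<And>i j. i < card D \<Longrightarrow> j < card D \<Longrightarrow> l2_inner (v i) (v j) = of_bool (i = j)"
    and f: "supported_on D f"
  shows "f = (\<lambda>x. \<Sum>i<card D. l2_inner f (v i) * v i x)"
proof (rule ccontr)
  assume contra: "\<not> ?thesis"
  define g where "g = (\<lambda>x. f x - (\<Sum>i<card D. l2_inner f (v i) * v i x))"
  have g: "supported_on D g"
    unfolding g_def using f v by (intro supported_on_diff supported_on_sum) auto
  have g0: "g \<noteq> (\<lambda>x. 0)"
    using contra by (auto simp: g_def fun_eq_iff)
  have gv: "l2_inner g (v j) = 0" if "j < card D" for j
  proof -
    have "(\<Sum>i<card D. l2_inner f (v i) * l2_inner (v i) (v j))
        = (\<Sum>i<card D. if i = j then l2_inner f (v j) else 0)"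
      using that orth by (intro sum.cong) auto
    then show ?thesis
      using that
      by (simp add: g_def l2_inner_diff_left[OF D v[OF that]] l2_inner_sum_left[OF D v[OF that]])
  qed
  define w where "w = v(card D := g)"
  have w: "supported_on D (w i)" if "i \<le> card D" for i
    using that g v by (auto simp: w_def)
  \<comment> \<open>\<open>card D + 1\<close> vectors in a space cut out by \<open>card D\<close> coordinates are linearly dependent\<close>
  obtain c where c: "\<exists>i\<in>{..card D}. c i \<noteq> 0"
    "\<And>x. x \<in> D \<Longrightarrow> (\<Sum>i\<le>card D. c i * w i x) = 0"
    using homogeneous_system_nontrivial[of D "{..card D}" w] D by auto
  have "(\<Sum>i\<le>card D. c i * w i x) = 0" for x
    using c(2) w by (cases "x \<in> D") (auto simp: supported_on_def)
  then have zero: "(\<Sum>i\<le>card D. c i * l2_inner (w i) (w j)) = 0" if "j \<le> card D" for j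
    using l2_inner_sum_left[OF D w[OF that], where I="{..card D}" and c=c and v=w]
    by (simp add: l2_inner_def)
  have vg: "l2_inner (v j) g = 0" if "j < card D" for j
    using l2_inner_cnj[OF D g, of "v j"] gv[OF that] by simp
  have ww: "l2_inner (w i) (w j) = 0" if "i \<le> card D" "j \<le> card D" "i \<noteq> j" for i j
    using that orth gv vg by (auto simp: w_def)
  have "l2_inner (w j) (w j) \<noteq> 0" if "j \<le> card D" for j
    using that orth l2_inner_self_pos[OF D g g0] by (cases "j = card D") (auto simp: w_def)
  moreover have "c j * l2_inner (w j) (w j) = 0" if "j \<le> card D" for j
  proof -
    have "(\<Sum>i\<le>card D. c i * l2_inner (w i) (w j))
        = (\<Sum>i\<in>{..card D}. if i = j then c j * l2_inner (w j) (w j) else 0)"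
      using ww that by (intro sum.cong) auto
    then show ?thesis using zero[OF that] that by simp
  qed
  ultimately show False using c(1) by auto
qed

section \<open>The spectral theorem on a finite set\<close>

text \<open>
  The operator is linear on all functions but self-adjoint only on the copy of \<open>\<complex>\<^sup>D\<close> formed by the
  functions supported on \<open>D\<close>, which it preserves.
\<close>

locale selfadjoint_on =
  fixes D :: "'a set" and T :: "('a \<Rightarrow> complex) \<Rightarrow> 'a \<Rightarrow> complex"
  assumes finite: "finite D"
    and supported: "supported_on D f \<Longrightarrow> supported_on D (T f)"
    and add: "T (\<lambda>x. f x + g x) = (\<lambda>x. T f x + T g x)"
    and scale: "T (\<lambda>x. c * f x) = (\<lambda>x. c * T f x)"
    and selfadjoint: "supported_on D f \<Longrightarrow> supported_on D g \<Longrightarrow> l2_inner (T f) g = l2_inner f (T g)"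
begin

lemma diff_scale: "T (\<lambda>x. f x - c * g x) = (\<lambda>x. T f x - c * T g x)"
  using add[of f "\<lambda>x. (- c) * g x"] scale[of "- c" g] by simp

lemma funpow_supported: "supported_on D f \<Longrightarrow> supported_on D ((T ^^ i) f)"
  by (induction i) (auto intro: supported)

lemma funpow_diff_scale: "(T ^^ i) (\<lambda>x. f x - c * g x) = (\<lambda>x. (T ^^ i) f x - c * (T ^^ i) g x)"
  by (induction i) (auto simp: diff_scale)

lemma eigenvalue_real:
  assumes f: "supported_on D f" "f \<noteq> (\<lambda>x. 0)" and T: "T f = (\<lambda>x. z * f x)"
  shows "z = of_real (Re z)"
proof -
  have "z * l2_inner f f = cnj z * l2_inner f f"
    using selfadjoint[OF f(1) f(1)] unfolding T
    by (simp add: l2_inner_scale_left[OF finite f(1)] l2_inner_scale_right[OF finite f(1)])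
  moreover have "l2_inner f f \<noteq> 0"
    using l2_inner_self_pos[OF finite f] by auto
  ultimately have "z = cnj z" by simp
  then show ?thesis by (simp add: complex_eq_iff)
qed

text \<open>
  The set \<open>S\<close> plays the part of an invariant subspace. A polynomial annihilating a nonzero vector
  splits into linear factors over \<open>\<complex>\<close>; removing them one at a time, the last nonzero vector
  met is an eigenvector.
\<close>

lemma eigenvector_of_annihilating_poly:
  assumes S: "\<And>f c. f \<in> S \<Longrightarrow> (\<lambda>x. T f x - c * f x) \<in> S"
    and "f \<in> S" "f \<noteq> (\<lambda>x. 0)" "p \<noteq> 0" "degree p = n"
    and "\<And>x. (\<Sum>i\<le>n. coeff p i * (T ^^ i) f x) = 0"
  shows "\<exists>g\<in>S. \<exists>z. g \<noteq> (\<lambda>x. 0) \<and> T g = (\<lambda>x. z * g x)"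
  using assms(2-)
proof (induction n arbitrary: p f)
  case 0
  then have "coeff p 0 \<noteq> 0" by (metis leading_coeff_0_iff)
  with 0 show ?case by auto
next
  case (Suc n)
  have "\<not> constant (poly p)" using Suc.prems(4) by (simp add: constant_degree)
  then obtain z where "poly p z = 0"
    using fundamental_theorem_of_algebra by blast
  then obtain q where q: "p = [:- z, 1:] * q"
    unfolding poly_eq_0_iff_dvd by (auto elim: dvdE)
  with Suc.prems(3) have "q \<noteq> 0" by auto
  with q Suc.prems(4) have deg: "degree q = n"
    by (simp add: degree_mult_eq del: mult_pCons_left)
  have coeff_p: "coeff p 0 = - z * coeff q 0"
    "coeff p (Suc i) = coeff q i - z * coeff q (Suc i)" for i
    unfolding q by simp_all
  define w where "w = (\<lambda>x. T f x - z * f x)"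
  show ?case
  proof (cases "w = (\<lambda>x. 0)")
    case True
    then have "T f = (\<lambda>x. z * f x)" by (auto simp: w_def fun_eq_iff)
    with Suc.prems show ?thesis by blast
  next
    case False
    have "w \<in> S" unfolding w_def using Suc.prems S by blast
    \<comment> \<open>dividing out the root \<open>z\<close> turns a polynomial annihilating \<open>f\<close> into one annihilating \<open>(T - z) f\<close>\<close>
    have "(\<Sum>i\<le>n. coeff q i * (T ^^ i) w x) = 0" for x
    proof -
      have "(\<Sum>i\<le>n. coeff q i * (T ^^ i) w x)
          = (\<Sum>i\<le>n. coeff q i * (T ^^ Suc i) f x) - z * (\<Sum>i\<le>n. coeff q i * (T ^^ i) f x)"
        unfolding w_def funpow_diff_scale
        by (simp add: sum_subtractf sum_distrib_left algebra_simps funpow_swap1)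
      also have "(\<Sum>i\<le>n. coeff q i * (T ^^ i) f x) = (\<Sum>i\<le>Suc n. coeff q i * (T ^^ i) f x)"
        using deg by (simp add: coeff_eq_0)
      also have "(\<Sum>i\<le>n. coeff q i * (T ^^ Suc i) f x) - z * (\<Sum>i\<le>Suc n. coeff q i * (T ^^ i) f x)
          = (\<Sum>i\<le>Suc n. coeff p i * (T ^^ i) f x)"
        unfolding sum.atMost_Suc_shift coeff_p
        by (simp add: sum_subtractf sum_distrib_left algebra_simps)
      finally show ?thesis using Suc.prems(5) by simp
    qed
    with Suc.IH[OF \<open>w \<in> S\<close> False \<open>q \<noteq> 0\<close> deg] show ?thesis by blast
  qed
qed

text \<open>
  The \<open>card D + 1\<close> vectors \<open>f, T f, T\<^sup>2 f, \<dots>\<close> are linearly dependent, and a dependency is an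
  annihilating polynomial.
\<close>

lemma eigenvector_exists:
  assumes S: "\<And>f c. f \<in> S \<Longrightarrow> (\<lambda>x. T f x - c * f x) \<in> S"
    and sup: "\<And>f. f \<in> S \<Longrightarrow> supported_on D f"
    and f: "f \<in> S" "f \<noteq> (\<lambda>x. 0)"
  shows "\<exists>g\<in>S. \<exists>\<mu>. g \<noteq> (\<lambda>x. 0) \<and> T g = (\<lambda>x. of_real \<mu> * g x)"
proof -
  obtain c where c: "\<exists>i\<in>{..card D}. c i \<noteq> 0"
    "\<And>x. x \<in> D \<Longrightarrow> (\<Sum>i\<le>card D. c i * (T ^^ i) f x) = 0"
    using homogeneous_system_nontrivial[of D "{..card D}" "\<lambda>i. (T ^^ i) f"] finite by auto
  define p where "p = Poly (map c [0..<Suc (card D)])"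
  have coeff_p: "coeff p i = (if i \<le> card D then c i else 0)" for i
    by (auto simp: p_def nth_default_def simp del: upt_Suc)
  then have "p \<noteq> 0" using c(1) by (metis atMost_iff coeff_0)
  have deg: "degree p \<le> card D"
    by (rule degree_le) (simp add: coeff_p)
  have "(\<Sum>i\<le>degree p. coeff p i * (T ^^ i) f x) = 0" for x
  proof -
    have "(\<Sum>i\<le>degree p. coeff p i * (T ^^ i) f x) = (\<Sum>i\<le>card D. coeff p i * (T ^^ i) f x)"
      using deg by (intro sum.mono_neutral_left) (auto simp: coeff_eq_0)
    also have "\<dots> = (\<Sum>i\<le>card D. c i * (T ^^ i) f x)"
      by (intro sum.cong) (auto simp: coeff_p)
    also have "\<dots> = 0"
      using c(2) funpow_supported[OF sup[OF f(1)]]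
      by (cases "x \<in> D") (auto simp: supported_on_def)
    finally show ?thesis .
  qed
  from eigenvector_of_annihilating_poly[OF S f \<open>p \<noteq> 0\<close> refl this]
  obtain g z where g: "g \<in> S" "g \<noteq> (\<lambda>x. 0)" "T g = (\<lambda>x. z * g x)" by blast
  with eigenvalue_real[OF sup] have "z = of_real (Re z)" by blast
  with g show ?thesis by metis
qed

text \<open>
  The orthogonal complement of eigenvectors is invariant under a self-adjoint operator, and it is
  nonzero as long as fewer than \<open>card D\<close> of them have been found; so it contains a further one.
\<close>

lemma orthonormal_eigenvectors:
  "n \<le> card D \<Longrightarrow> \<exists>v \<mu>. (\<forall>i<n. supported_on D (v i) \<and> T (v i) = (\<lambda>x. of_real (\<mu> i) * v i x)) \<and>
     (\<forall>i<n. \<forall>j<n. l2_inner (v i) (v j) = of_bool (i = j))"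
proof (induction n)
  case 0
  then show ?case by simp
next
  case (Suc n)
  then obtain v \<mu> where
    "\<forall>i<n. supported_on D (v i) \<and> T (v i) = (\<lambda>x. of_real (\<mu> i) * v i x)"
    "\<forall>i<n. \<forall>j<n. l2_inner (v i) (v j) = of_bool (i = j)"
    using Suc_leD by blast
  then have v: "\<And>i. i < n \<Longrightarrow> supported_on D (v i)"
    "\<And>i. i < n \<Longrightarrow> T (v i) = (\<lambda>x. of_real (\<mu> i) * v i x)"
    "\<And>i j. i < n \<Longrightarrow> j < n \<Longrightarrow> l2_inner (v i) (v j) = of_bool (i = j)"
    by simp_all
  define S where "S = {f. supported_on D f \<and> (\<forall>i<n. l2_inner f (v i) = 0)}"
  have S: "(\<lambda>x. T f x - c * f x) \<in> S" if "f \<in> S" for f c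
  proof -
    have f: "supported_on D f" "\<And>i. i < n \<Longrightarrow> l2_inner f (v i) = 0"
      using that by (auto simp: S_def)
    have "l2_inner (\<lambda>x. T f x - c * f x) (v i) = 0" if "i < n" for i
      using f that v
      by (simp add: l2_inner_diff_left[OF finite v(1)] l2_inner_scale_left[OF finite v(1)]
          selfadjoint l2_inner_scale_right[OF finite f(1)])
    then show ?thesis
      using f by (auto simp: S_def intro!: supported_on_diff supported supported_on_scale)
  qed
  obtain c where c: "\<exists>x\<in>D. c x \<noteq> 0" "\<And>j. j < n \<Longrightarrow> (\<Sum>x\<in>D. c x * cnj (v j x)) = 0"
    using homogeneous_system_nontrivial[of "{..<n}" D "\<lambda>x j. cnj (v j x)"] finite Suc.prems
    by auto
  have "zero_extension D c \<in> S"
    using c(2) by (simp add: S_def l2_inner_left[OF finite supported_on_zero_extension])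
      (simp add: zero_extension_def)
  moreover have "zero_extension D c \<noteq> (\<lambda>x. 0)"
    using c(1) by (auto simp: zero_extension_def fun_eq_iff)
  ultimately obtain g \<gamma> where g: "g \<in> S" "g \<noteq> (\<lambda>x. 0)" "T g = (\<lambda>x. of_real \<gamma> * g x)"
    using eigenvector_exists[of S "zero_extension D c"] S unfolding S_def by blast
  have gS: "supported_on D g" "\<And>i. i < n \<Longrightarrow> l2_inner g (v i) = 0"
    using g by (auto simp: S_def)
  define r where "r = sqrt (Re (l2_inner g g))"
  have r: "r > 0" "l2_inner g g = of_real (r * r)"
    using l2_inner_self_pos[OF finite gS(1) g(2)] l2_inner_self_real[OF finite gS(1)]
    by (auto simp: r_def)
  define h where "h = (\<lambda>x. of_real (1 / r) * g x)"
  have h: "supported_on D h" unfolding h_def by (rule supported_on_scale[OF gS(1)])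
  have Th: "T h = (\<lambda>x. of_real \<gamma> * h x)"
    unfolding h_def scale g(3) by (simp add: fun_eq_iff)
  have hh: "l2_inner h h = 1"
  proof -
    have "l2_inner h h = of_real (1 / r) * (cnj (of_real (1 / r)) * l2_inner g g)"
      unfolding h_def l2_inner_scale_left[OF finite h[unfolded h_def]]
        l2_inner_scale_right[OF finite gS(1)] ..
    then show ?thesis using r by simp
  qed
  have hv: "l2_inner h (v i) = 0" if "i < n" for i
    unfolding h_def l2_inner_scale_left[OF finite v(1)[OF that]] using gS(2) that by simp
  have vh: "l2_inner (v i) h = 0" if "i < n" for i
    using l2_inner_cnj[OF finite h, of "v i"] hv[OF that] by simp
  show ?case
    by (rule exI[of _ "v(n := h)"], rule exI[of _ "\<mu>(n := \<gamma>)"])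
      (auto simp: less_Suc_eq v h Th hh hv vh)
qed

definition eigenbasis :: "(nat \<Rightarrow> 'a \<Rightarrow> complex) \<Rightarrow> (nat \<Rightarrow> real) \<Rightarrow> bool" where
  "eigenbasis v \<mu> \<longleftrightarrow>
     (\<forall>i<card D. supported_on D (v i) \<and> T (v i) = (\<lambda>x. of_real (\<mu> i) * v i x)) \<and>
     (\<forall>i<card D. \<forall>j<card D. l2_inner (v i) (v j) = of_bool (i = j)) \<and>
     (\<forall>i j. i \<le> j \<longrightarrow> j < card D \<longrightarrow> \<mu> i \<le> \<mu> j)"

lemma eigenbasis_exists: "\<exists>v \<mu>. eigenbasis v \<mu>"
proof -
  obtain v \<mu> where
    "\<forall>i<card D. supported_on D (v i) \<and> T (v i) = (\<lambda>x. of_real (\<mu> i) * v i x)"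
    "\<forall>i<card D. \<forall>j<card D. l2_inner (v i) (v j) = of_bool (i = j)"
    using orthonormal_eigenvectors[OF order.refl] by blast
  then have v: "\<And>i. i < card D \<Longrightarrow> supported_on D (v i)"
    "\<And>i. i < card D \<Longrightarrow> T (v i) = (\<lambda>x. of_real (\<mu> i) * v i x)"
    "\<And>i j. i < card D \<Longrightarrow> j < card D \<Longrightarrow> l2_inner (v i) (v j) = of_bool (i = j)"
    by simp_all
  define xs where "xs = sort_key \<mu> [0..<card D]"
  have xs: "length xs = card D" "set xs = {0..<card D}" "distinct xs" "sorted (map \<mu> xs)"
    by (simp_all add: xs_def)
  have lt: "xs ! i < card D" if "i < card D" for i
    using that xs by (metis atLeastLessThan_iff nth_mem)
  have "eigenbasis (\<lambda>i. v (xs ! i)) (\<lambda>i. \<mu> (xs ! i))"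
    unfolding eigenbasis_def
    using v lt xs sorted_nth_mono[OF xs(4)] by (auto simp: nth_eq_iff_index_eq)
  then show ?thesis by blast
qed

lemma eigenspace_eq:
  "eigenspace_on D T m = {f. supported_on D f \<and> T f = (\<lambda>x. of_real m * f x)}"
proof -
  have "(\<forall>x\<in>D. T f x = of_real m * f x) \<longleftrightarrow> T f = (\<lambda>x. of_real m * f x)"
    if "supported_on D f" for f
    using that supported[OF that] by (auto simp: supported_on_def fun_eq_iff)
  then show ?thesis by (auto simp: eigenspace_on_def supported_on_def)
qed

context
  fixes v \<mu>
  assumes eb: "eigenbasis v \<mu>"
begin

lemma eigenbasis_facts:
  "i < card D \<Longrightarrow> supported_on D (v i)"
  "i < card D \<Longrightarrow> T (v i) = (\<lambda>x. of_real (\<mu> i) * v i x)"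
  "i < card D \<Longrightarrow> j < card D \<Longrightarrow> l2_inner (v i) (v j) = of_bool (i = j)"
  "i \<le> j \<Longrightarrow> j < card D \<Longrightarrow> \<mu> i \<le> \<mu> j"
  using eb by (auto simp: eigenbasis_def)

lemma eigenbasis_expansion:
  "supported_on D f \<Longrightarrow> f = (\<lambda>x. \<Sum>i<card D. l2_inner f (v i) * v i x)"
  by (rule orthonormal_family_complete[OF finite]) (auto simp: eigenbasis_facts)

lemma eigenbasis_parseval:
  assumes f: "supported_on D f" and g: "supported_on D g"
  shows "l2_inner f g = (\<Sum>i<card D. l2_inner f (v i) * cnj (l2_inner g (v i)))"
proof -
  have "l2_inner f g = l2_inner (\<lambda>x. \<Sum>i<card D. l2_inner f (v i) * v i x) g"
    using eigenbasis_expansion[OF f] by simp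
  also have "\<dots> = (\<Sum>i<card D. l2_inner f (v i) * l2_inner (v i) g)"
    by (rule l2_inner_sum_left[OF finite g])
  also have "\<dots> = (\<Sum>i<card D. l2_inner f (v i) * cnj (l2_inner g (v i)))"
    by (simp add: l2_inner_cnj[OF finite g])
  finally show ?thesis .
qed

lemma eigenbasis_coefficient:
  assumes "supported_on D f" "i < card D"
  shows "l2_inner (T f) (v i) = of_real (\<mu> i) * l2_inner f (v i)"
  using assms
  by (simp add: selfadjoint eigenbasis_facts l2_inner_scale_right[OF finite])

lemma eigenbasis_norm:
  assumes f: "supported_on D f"
  shows "Re (l2_inner f f) = (\<Sum>i<card D. (cmod (l2_inner f (v i)))\<^sup>2)"
  unfolding eigenbasis_parseval[OF f f] complex_norm_square[symmetric] of_real_sum[symmetric]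
  by simp

lemma eigenbasis_form:
  assumes f: "supported_on D f"
  shows "Re (l2_inner (T f) f) = (\<Sum>i<card D. \<mu> i * (cmod (l2_inner f (v i)))\<^sup>2)"
proof -
  have "l2_inner (T f) f = (\<Sum>i<card D. of_real (\<mu> i * (cmod (l2_inner f (v i)))\<^sup>2))"
    unfolding eigenbasis_parseval[OF supported[OF f] f]
    by (intro sum.cong)
      (simp_all add: eigenbasis_coefficient[OF f] complex_norm_square mult.assoc del: of_real_power)
  then show ?thesis by (simp add: del: of_real_mult)
qed

lemma eigenbasis_image_norm:
  assumes f: "supported_on D f"
  shows "Re (l2_inner (T f) (T f)) = (\<Sum>i<card D. (\<mu> i)\<^sup>2 * (cmod (l2_inner f (v i)))\<^sup>2)"
  unfolding eigenbasis_norm[OF supported[OF f]]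
  by (intro sum.cong) (simp_all add: eigenbasis_coefficient[OF f] norm_mult power_mult_distrib)

text \<open>
  The basis vectors with eigenvalue \<open>m\<close> are a basis of the eigenspace: comparing coefficients in
  \<open>T f = m f\<close> shows that an eigenvector has no component along the others.
\<close>

lemma dim_eigenspace: "cfun.dim (eigenspace_on D T m) = card {i. i < card D \<and> \<mu> i = m}"
proof -
  define I where "I = {i. i < card D \<and> \<mu> i = m}"
  have I: "i < card D" "\<mu> i = m" if "i \<in> I" for i using that by (auto simp: I_def)
  have "finite I" by (simp add: I_def)
  have inj: "inj_on v I"
  proof (rule inj_onI)
    fix i j assume ij: "i \<in> I" "j \<in> I" "v i = v j"
    then have "l2_inner (v i) (v j) = 1" using I eigenbasis_facts(3)[of i i] by simp
    then show "i = j" using ij I eigenbasis_facts(3)[of i j] by (auto simp: of_bool_def split: if_splits)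
  qed
  have sub: "v ` I \<subseteq> eigenspace_on D T m"
    unfolding eigenspace_eq using I by (auto simp: eigenbasis_facts)
  have "cfun.independent (v ` I)"
  proof
    assume "cfun.dependent (v ` I)"
    then obtain u where u: "\<exists>w\<in>v ` I. u w \<noteq> 0" "(\<Sum>w\<in>v ` I. (\<lambda>x. u w * w x)) = 0"
      using \<open>finite I\<close> by (auto simp: cfun.dependent_finite)
    then obtain j where j: "j \<in> I" "u (v j) \<noteq> 0" by auto
    have "(\<lambda>x. \<Sum>i\<in>I. u (v i) * v i x) = (\<lambda>x. 0)"
      using u(2) by (simp add: sum.reindex[OF inj] fun_eq_iff sum_fun_apply)
    then have "(\<Sum>i\<in>I. u (v i) * l2_inner (v i) (v j)) = 0"
      using l2_inner_sum_left[OF finite eigenbasis_facts(1)[OF I(1)[OF j(1)]],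
          where I=I and c="\<lambda>i. u (v i)" and v=v]
      by (simp add: l2_inner_def)
    moreover have "(\<Sum>i\<in>I. u (v i) * l2_inner (v i) (v j)) = (\<Sum>i\<in>I. if i = j then u (v j) else 0)"
      using I j by (intro sum.cong) (auto simp: eigenbasis_facts)
    ultimately show False using j \<open>finite I\<close> by simp
  qed
  moreover have "eigenspace_on D T m \<subseteq> cfun.span (v ` I)"
  proof
    fix f assume "f \<in> eigenspace_on D T m"
    then have f: "supported_on D f" "T f = (\<lambda>x. of_real m * f x)"
      by (auto simp: eigenspace_eq)
    have zero: "l2_inner f (v i) = 0" if "i < card D" "i \<notin> I" for i
    proof -
      have "of_real m * l2_inner f (v i) = of_real (\<mu> i) * l2_inner f (v i)"
        using eigenbasis_coefficient[OF f(1) that(1)] unfolding f(2)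
        by (simp add: l2_inner_scale_left[OF finite eigenbasis_facts(1)[OF that(1)]])
      then show ?thesis using that by (auto simp: I_def)
    qed
    have "f = (\<Sum>i\<in>I. (\<lambda>x. l2_inner f (v i) * v i x))"
    proof
      fix x
      have "f x = (\<Sum>i<card D. l2_inner f (v i) * v i x)"
        by (rule fun_cong[OF eigenbasis_expansion[OF f(1)]])
      also have "\<dots> = (\<Sum>i\<in>I. l2_inner f (v i) * v i x)"
        using zero by (intro sum.mono_neutral_right) (auto simp: I_def)
      finally show "f x = (\<Sum>i\<in>I. (\<lambda>x. l2_inner f (v i) * v i x)) x"
        by (simp add: sum_fun_apply)
    qed
    also have "\<dots> \<in> cfun.span (v ` I)"
      by (intro cfun.span_sum cfun.span_scale cfun.span_base) auto
    finally show "f \<in> cfun.span (v ` I)" .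
  qed
  ultimately have "card (v ` I) = cfun.dim (eigenspace_on D T m)"
    using sub by (intro cfun.basis_card_eq_dim)
  with card_image[OF inj] show ?thesis unfolding I_def by simp
qed

text \<open>
  A sorted list is determined by its multiplicities, so the eigenvalues of any ordered
  orthonormal eigenbasis form the list singled out by the definite description.
\<close>

lemma real_eigenvalues_eq: "real_eigenvalues_on D T = map \<mu> [0..<card D]"
proof -
  have sorted: "sorted (map \<mu> [0..<card D])"
    by (auto simp: sorted_iff_nth_mono eigenbasis_facts(4))
  have count: "count_list (map \<mu> [0..<card D]) m = cfun.dim (eigenspace_on D T m)" for m
  proof -
    have "count_list (map \<mu> [0..<card D]) m = length (filter (\<lambda>i. \<mu> i = m) [0..<card D])"
    proof -
      have "(=) m \<circ> \<mu> = (\<lambda>i. \<mu> i = m)" by auto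
      then show ?thesis by (simp add: count_list_eq_length_filter filter_map)
    qed
    also have "\<dots> = card {i. i < card D \<and> \<mu> i = m}"
    proof -
      have "set (filter (\<lambda>i. \<mu> i = m) [0..<card D]) = {i. i < card D \<and> \<mu> i = m}" by auto
      then show ?thesis
        using distinct_card[of "filter (\<lambda>i. \<mu> i = m) [0..<card D]"] by simp
    qed
    finally show ?thesis by (simp add: dim_eigenspace)
  qed
  show ?thesis
    unfolding real_eigenvalues_on_def
  proof (rule the_equality)
    fix ys assume ys: "sorted ys \<and> (\<forall>m. count_list ys m = cfun.dim (eigenspace_on D T m))"
    have "mset ys = mset (map \<mu> [0..<card D])"
    proof (rule multiset_eqI)
      fix m
      show "count (mset ys) m = count (mset (map \<mu> [0..<card D])) m"
        unfolding count_mset using count[of m] ys by metis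
    qed
    then have "sort (map \<mu> [0..<card D]) = ys"
      using ys by (intro properties_for_sort) auto
    then show "ys = map \<mu> [0..<card D]"
      unfolding sorted_sort_id[OF sorted] ..
  qed (use sorted count in auto)
qed

end

end

section \<open>Comparing the spectra of two operators\<close>

text \<open>
  This is the min-max argument for \<open>B\<^sup>2 \<le> C\<close>. Positivity of \<open>B\<close> ensures that squaring keeps the order of
  its eigenvalues. For the strict version, the bound \<open>(\<lambda>\<^sub>k(B))\<^sup>2 \<parallel>f\<parallel>\<^sup>2 \<le> \<parallel>B f\<parallel>\<^sup>2\<close> at the test
  vector is either strict already or \<open>f\<close> is an eigenvector of \<open>B\<close>; hence strictness of the
  hypothesis is required on eigenvectors only. Indices of list entries start at 0.
\<close>

lemma eigenvalue_square_comparison: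
  assumes "selfadjoint_on D B" "selfadjoint_on D C"
    and pos: "\<And>f. supported_on D f \<Longrightarrow> 0 \<le> Re (l2_inner (B f) f)"
    and le: "\<And>f. supported_on D f \<Longrightarrow> Re (l2_inner (B f) (B f)) \<le> Re (l2_inner (C f) f)"
    and k: "k < card D"
  shows "(real_eigenvalues_on D B ! k)\<^sup>2 \<le> real_eigenvalues_on D C ! k"
    and "(\<And>f m. \<lbrakk>supported_on D f; f \<noteq> (\<lambda>x. 0); B f = (\<lambda>x. of_real m * f x)\<rbrakk>
            \<Longrightarrow> Re (l2_inner (B f) (B f)) < Re (l2_inner (C f) f))
         \<Longrightarrow> (real_eigenvalues_on D B ! k)\<^sup>2 < real_eigenvalues_on D C ! k"
proof -
  interpret B: selfadjoint_on D B by fact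
  interpret C: selfadjoint_on D C by fact
  obtain w \<beta> where w: "B.eigenbasis w \<beta>" using B.eigenbasis_exists by blast
  obtain u \<gamma> where u: "C.eigenbasis u \<gamma>" using C.eigenbasis_exists by blast
  note wf = B.eigenbasis_facts[OF w]
  note uf = C.eigenbasis_facts[OF u]
  have \<beta>_nonneg: "0 \<le> \<beta> i" if "i < card D" for i
    using pos[OF wf(1)[OF that]] that
    by (simp add: wf(2,3) l2_inner_scale_left[OF B.finite wf(1)])
  \<comment> \<open>\<open>k\<close> orthogonality conditions on \<open>k + 1\<close> coefficients leave a nonzero test vector\<close>
  obtain c where c: "\<exists>i\<in>{..k}. c i \<noteq> 0"
    "\<And>j. j < k \<Longrightarrow> (\<Sum>i\<le>k. c i * l2_inner (u i) (w j)) = 0"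
    using homogeneous_system_nontrivial[of "{..<k}" "{..k}" "\<lambda>i j. l2_inner (u i) (w j)"] by auto
  define f where "f = (\<lambda>x. \<Sum>i\<le>k. c i * u i x)"
  have f: "supported_on D f"
    unfolding f_def using k by (intro supported_on_sum uf) auto
  have fw: "l2_inner f (w j) = 0" if "j < k" for j
    using c(2)[OF that] that k by (simp add: f_def l2_inner_sum_left[OF B.finite wf(1)])
  have fu: "l2_inner f (u j) = (if j \<le> k then c j else 0)" if "j < card D" for j
  proof -
    have "l2_inner f (u j) = (\<Sum>i\<le>k. if i = j then c j else 0)"
      unfolding f_def l2_inner_sum_left[OF B.finite uf(1)[OF that]]
      using that k by (intro sum.cong) (auto simp: uf(3))
    then show ?thesis by simp
  qed
  have f0: "f \<noteq> (\<lambda>x. 0)"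
  proof
    assume "f = (\<lambda>x. 0)"
    then have "l2_inner f (u i) = 0" for i by (simp add: l2_inner_def)
    with fu have "c i = 0" if "i \<le> k" for i
      using that k le_less_trans[OF that k] by (metis (full_types))
    with c(1) show False by auto
  qed
  have upper: "Re (l2_inner (C f) f) \<le> \<gamma> k * Re (l2_inner f f)"
    unfolding C.eigenbasis_form[OF u f] C.eigenbasis_norm[OF u f] sum_distrib_left
  proof (rule sum_mono)
    fix i assume "i \<in> {..<card D}"
    then show "\<gamma> i * (cmod (l2_inner f (u i)))\<^sup>2 \<le> \<gamma> k * (cmod (l2_inner f (u i)))\<^sup>2"
      using uf(4)[of i k] k by (cases "i \<le> k") (auto simp: fu intro: mult_right_mono)
  qed
  have term_le: "(\<beta> k)\<^sup>2 * (cmod (l2_inner f (w i)))\<^sup>2 \<le> (\<beta> i)\<^sup>2 * (cmod (l2_inner f (w i)))\<^sup>2"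
    if "i < card D" for i
    using fw[of i] wf(4)[of k i] \<beta>_nonneg[OF k] that
    by (cases "i < k") (auto intro!: mult_right_mono power_mono)
  have lower: "(\<beta> k)\<^sup>2 * Re (l2_inner f f) \<le> Re (l2_inner (B f) (B f))"
    unfolding B.eigenbasis_image_norm[OF w f] B.eigenbasis_norm[OF w f] sum_distrib_left
    using term_le by (intro sum_mono) auto
  have eigen: "B f = (\<lambda>x. of_real (\<beta> k) * f x)"
    if "(\<beta> k)\<^sup>2 * Re (l2_inner f f) = Re (l2_inner (B f) (B f))"
  proof -
    have eq: "(\<beta> k)\<^sup>2 * (cmod (l2_inner f (w i)))\<^sup>2 = (\<beta> i)\<^sup>2 * (cmod (l2_inner f (w i)))\<^sup>2"
      if "i < card D" for i
    proof (rule ccontr)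
      assume "\<not> ?thesis"
      with term_le[OF that] have "(\<beta> k)\<^sup>2 * (cmod (l2_inner f (w i)))\<^sup>2 < (\<beta> i)\<^sup>2 * (cmod (l2_inner f (w i)))\<^sup>2"
        by simp
      then have "(\<beta> k)\<^sup>2 * Re (l2_inner f f) < Re (l2_inner (B f) (B f))"
        unfolding B.eigenbasis_image_norm[OF w f] B.eigenbasis_norm[OF w f] sum_distrib_left
        using term_le that by (intro sum_strict_mono_ex1) auto
      then show False using \<open>(\<beta> k)\<^sup>2 * Re (l2_inner f f) = _\<close> by simp
    qed
    have coeff: "l2_inner (B f) (w i) = of_real (\<beta> k) * l2_inner f (w i)" if "i < card D" for i
      using eq[OF that] \<beta>_nonneg[OF k] \<beta>_nonneg[OF that]
      by (auto simp: B.eigenbasis_coefficient[OF w f that] power2_eq_iff_nonneg)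
    have "B f = (\<lambda>x. \<Sum>i<card D. l2_inner (B f) (w i) * w i x)"
      by (rule B.eigenbasis_expansion[OF w B.supported[OF f]])
    also have "\<dots> = (\<lambda>x. of_real (\<beta> k) * (\<Sum>i<card D. l2_inner f (w i) * w i x))"
      by (simp add: coeff sum_distrib_left mult.assoc)
    also have "\<dots> = (\<lambda>x. of_real (\<beta> k) * f x)"
      using B.eigenbasis_expansion[OF w f] by metis
    finally show ?thesis .
  qed
  have nth: "real_eigenvalues_on D B ! k = \<beta> k" "real_eigenvalues_on D C ! k = \<gamma> k"
    using k by (simp_all add: B.real_eigenvalues_eq[OF w] C.real_eigenvalues_eq[OF u])
  have norm: "0 < Re (l2_inner f f)" by (rule l2_inner_self_pos[OF B.finite f f0])
  have "(\<beta> k)\<^sup>2 * Re (l2_inner f f) \<le> \<gamma> k * Re (l2_inner f f)"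
    using lower le[OF f] upper by linarith
  then show "(real_eigenvalues_on D B ! k)\<^sup>2 \<le> real_eigenvalues_on D C ! k"
    unfolding nth using norm by simp
  assume strict: "\<And>f m. \<lbrakk>supported_on D f; f \<noteq> (\<lambda>x. 0); B f = (\<lambda>x. of_real m * f x)\<rbrakk>
            \<Longrightarrow> Re (l2_inner (B f) (B f)) < Re (l2_inner (C f) f)"
  have "(\<beta> k)\<^sup>2 * Re (l2_inner f f) < \<gamma> k * Re (l2_inner f f)"
  proof (cases "(\<beta> k)\<^sup>2 * Re (l2_inner f f) = Re (l2_inner (B f) (B f))")
    case True
    then show ?thesis using strict[OF f f0 eigen[OF True]] upper by linarith
  next
    case False
    then show ?thesis using lower le[OF f] upper by linarith
  qed
  then show "(real_eigenvalues_on D B ! k)\<^sup>2 < real_eigenvalues_on D C ! k"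
    unfolding nth using norm by simp
qed

section \<open>Powers of the graph Laplacian\<close>

locale locally_finite_graph =
  fixes G :: "'a pair_pre_digraph"
  assumes symmetric: "(x, y) \<in> parcs G \<Longrightarrow> (y, x) \<in> parcs G"
    and finite_neighbours: "finite {y. (x, y) \<in> parcs G}"
begin

abbreviation L where "L \<equiv> laplacian G"

lemma laplacian_add: "L (\<lambda>x. f x + g x) = (\<lambda>x. L f x + L g x)"
  by (simp add: laplacian_def fun_eq_iff sum.distrib[symmetric] algebra_simps)

lemma laplacian_scale: "L (\<lambda>x. c * f x) = (\<lambda>x. c * L f x)"
  by (simp add: laplacian_def fun_eq_iff sum_distrib_left algebra_simps)

lemma laplacian_power_add: "(L ^^ n) (\<lambda>x. f x + g x) = (\<lambda>x. (L ^^ n) f x + (L ^^ n) g x)"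
  by (induction n) (auto simp: laplacian_add)

lemma laplacian_power_scale: "(L ^^ n) (\<lambda>x. c * f x) = (\<lambda>x. c * (L ^^ n) f x)"
  by (induction n) (auto simp: laplacian_scale)

lemma laplacian_supported:
  assumes "supported_on D f"
  shows "supported_on (D \<union> (\<Union>x\<in>D. {y. (x, y) \<in> parcs G})) (L f)"
  unfolding supported_on_def laplacian_def
  using assms symmetric by (auto simp: supported_on_def intro!: sum.neutral)

lemma laplacian_power_supported:
  assumes "finite D" "supported_on D f"
  shows "\<exists>D'. finite D' \<and> supported_on D' ((L ^^ n) f)"
proof (induction n)
  case 0
  then show ?case using assms by auto
next
  case (Suc n)
  then obtain D' where "finite D'" "supported_on D' ((L ^^ n) f)" by blast
  with laplacian_supported[of D' "(L ^^ n) f"] finite_neighbours show ?case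
    by (intro exI[of _ "D' \<union> (\<Union>x\<in>D'. {y. (x, y) \<in> parcs G})"]) auto
qed

text \<open>
  Summing only over \<open>D\<close> separates the adjacency part, which is symmetric in \<open>x\<close> and \<open>y\<close>, from the
  degrees, which still count the neighbours outside \<open>D\<close>. Symmetry and sign of the Laplacian can
  both be read off from this form.
\<close>

lemma laplacian_form:
  assumes D: "finite D" and f: "supported_on D f" and g: "supported_on D g"
  shows "l2_inner (L f) g = (\<Sum>x\<in>D. \<Sum>y\<in>D. if (x, y) \<in> parcs G then f y * cnj (g x) else 0)
     - (\<Sum>x\<in>D. of_nat (card {y. (x, y) \<in> parcs G}) * (f x * cnj (g x)))"
proof -
  have Lf: "L f x = (\<Sum>y\<in>D. if (x, y) \<in> parcs G then f y else 0)
      - of_nat (card {y. (x, y) \<in> parcs G}) * f x" for x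
  proof -
    have "(\<Sum>y | (x, y) \<in> parcs G. f y) = (\<Sum>y\<in>{y\<in>D. (x, y) \<in> parcs G}. f y)"
      using f finite_neighbours[of x] by (intro sum.mono_neutral_right) (auto simp: supported_on_def)
    also have "\<dots> = (\<Sum>y\<in>D. if (x, y) \<in> parcs G then f y else 0)"
      by (rule sum.inter_filter[OF D])
    finally show ?thesis by (simp add: laplacian_def sum_subtractf)
  qed
  show ?thesis
    unfolding l2_inner_right[OF D g] Lf
    by (simp add: left_diff_distrib sum_subtractf sum_distrib_right mult.assoc
        if_distrib[where f="\<lambda>z. z * _"] cong: if_cong)
qed

lemma laplacian_symmetric:
  assumes "finite D" "supported_on D f" "finite D'" "supported_on D' g"
  shows "l2_inner (L f) g = l2_inner f (L g)"
proof -
  let ?D = "D \<union> D'"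
  have D: "finite ?D" "supported_on ?D f" "supported_on ?D g"
    using assms by (auto simp: supported_on_def)
  obtain D'' where D'': "finite D''" "supported_on D'' (L g)"
    using laplacian_power_supported[OF assms(3,4), of 1] by auto
  have "l2_inner f (L g) = cnj (l2_inner (L g) f)"
    by (rule l2_inner_cnj[OF D''])
  also have "\<dots> = l2_inner (L f) g"
    unfolding laplacian_form[OF D(1,3,2)] laplacian_form[OF D]
    by (subst sum.swap) (auto simp: mult.commute symmetric intro!: sum.cong)
  finally show ?thesis by simp
qed

lemma laplacian_power_symmetric:
  assumes "finite D" "supported_on D f" "finite D'" "supported_on D' g"
  shows "l2_inner ((L ^^ n) f) g = l2_inner f ((L ^^ n) g)"
  using assms
proof (induction n arbitrary: g D')
  case 0
  then show ?case by simp
next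
  case (Suc n)
  obtain E where E: "finite E" "supported_on E ((L ^^ n) f)"
    using laplacian_power_supported[OF Suc.prems(1,2)] by blast
  obtain F where F: "finite F" "supported_on F (L g)"
    using laplacian_power_supported[OF Suc.prems(3,4), of 1] by auto
  have "l2_inner ((L ^^ Suc n) f) g = l2_inner ((L ^^ n) f) (L g)"
    using laplacian_symmetric[OF E Suc.prems(3,4)] by simp
  also have "\<dots> = l2_inner f ((L ^^ n) (L g))"
    by (rule Suc.IH[OF Suc.prems(1,2) F])
  finally show ?case by (simp add: funpow_swap1)
qed

text \<open>
  By \<open>2 Re (f(y) \<cdot> cnj (f(x))) \<le> |f(x)|\<^sup>2 + |f(y)|\<^sup>2\<close> the adjacency part is at most
  the sum of \<open>|f(x)|\<^sup>2\<close> weighted by the number of neighbours of \<open>x\<close> in \<open>D\<close>, and this number is at most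
  the degree of \<open>x\<close>.
\<close>

lemma laplacian_nonpositive:
  assumes D: "finite D" and f: "supported_on D f"
  shows "Re (l2_inner (L f) f) \<le> 0"
proof -
  let ?N = "\<lambda>x. {y. (x, y) \<in> parcs G}"
  let ?a = "\<lambda>x y. if (x, y) \<in> parcs G then 1 else (0::real)"
  have sym: "?a x y = ?a y x" for x y using symmetric by auto
  have deg: "(\<Sum>y\<in>D. ?a x y) \<le> card (?N x)" for x
  proof -
    have "(\<Sum>y\<in>D. ?a x y) = card {y\<in>D. (x, y) \<in> parcs G}"
      using D by (simp flip: sum.inter_filter)
    also have "\<dots> \<le> card (?N x)"
      using finite_neighbours[of x] by (intro of_nat_mono card_mono) auto
    finally show ?thesis .
  qed
  have "Re (l2_inner (L f) f) = (\<Sum>x\<in>D. \<Sum>y\<in>D. ?a x y * Re (f y * cnj (f x)))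
      - (\<Sum>x\<in>D. card (?N x) * (cmod (f x))\<^sup>2)"
    unfolding laplacian_form[OF D f f] complex_norm_square[symmetric] minus_complex.sel Re_sum
    by (intro arg_cong2[of _ _ _ _ "(-)"] sum.cong) auto
  also have "(\<Sum>x\<in>D. \<Sum>y\<in>D. ?a x y * Re (f y * cnj (f x)))
      \<le> (\<Sum>x\<in>D. \<Sum>y\<in>D. ?a x y * (((cmod (f x))\<^sup>2 + (cmod (f y))\<^sup>2) / 2))"
  proof (intro sum_mono mult_left_mono)
    fix x y
    have "Re (f y * cnj (f x)) \<le> cmod (f x) * cmod (f y)"
      using complex_Re_le_cmod[of "f y * cnj (f x)"] by (simp add: norm_mult mult.commute)
    also have "\<dots> \<le> ((cmod (f x))\<^sup>2 + (cmod (f y))\<^sup>2) / 2"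
      using sum_squares_bound[of "cmod (f x)" "cmod (f y)"] by simp
    finally show "Re (f y * cnj (f x)) \<le> ((cmod (f x))\<^sup>2 + (cmod (f y))\<^sup>2) / 2" .
  qed auto
  also have "\<dots> = ((\<Sum>x\<in>D. \<Sum>y\<in>D. ?a x y * (cmod (f x))\<^sup>2) + (\<Sum>x\<in>D. \<Sum>y\<in>D. ?a x y * (cmod (f y))\<^sup>2)) / 2"
    by (simp only: sum.distrib[symmetric] sum_divide_distrib distrib_left add_divide_distrib times_divide_eq_right)
  also have "(\<Sum>x\<in>D. \<Sum>y\<in>D. ?a x y * (cmod (f y))\<^sup>2) = (\<Sum>x\<in>D. \<Sum>y\<in>D. ?a x y * (cmod (f x))\<^sup>2)"
    by (subst sum.swap) (simp only: sym)
  also have "(\<Sum>x\<in>D. \<Sum>y\<in>D. ?a x y * (cmod (f x))\<^sup>2) \<le> (\<Sum>x\<in>D. card (?N x) * (cmod (f x))\<^sup>2)"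
    unfolding sum_distrib_right[symmetric] by (intro sum_mono mult_right_mono deg) auto
  finally show ?thesis by simp
qed

text \<open>
  With \<open>g = \<Delta>\<^sup>m f\<close> and \<open>m = n div 2\<close>, the form is \<open>\<langle>g, g\<rangle>\<close> for even \<open>n\<close> and
  \<open>- \<langle>\<Delta> g, g\<rangle>\<close> for odd \<open>n\<close>.
\<close>

lemma laplacian_power_nonneg:
  assumes D: "finite D" and f: "supported_on D f"
  shows "0 \<le> (-1) ^ n * Re (l2_inner ((L ^^ n) f) f)"
proof -
  define m where "m = n div 2"
  obtain E where E: "finite E" "supported_on E ((L ^^ m) f)"
    using laplacian_power_supported[OF D f] by blast
  show ?thesis
  proof (cases "even n")
    case True
    then have n: "n = m + m" unfolding m_def by presburger
    have "l2_inner ((L ^^ n) f) f = l2_inner ((L ^^ m) f) ((L ^^ m) f)"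
      unfolding n funpow_add o_apply by (rule laplacian_power_symmetric[OF E D f])
    then show ?thesis using True l2_inner_self_nonneg[OF E] by simp
  next
    case False
    then have n: "n = m + Suc m" unfolding m_def by presburger
    obtain F where F: "finite F" "supported_on F (L ((L ^^ m) f))"
      using laplacian_power_supported[OF E, of 1] by auto
    have "l2_inner ((L ^^ n) f) f = l2_inner (L ((L ^^ m) f)) ((L ^^ m) f)"
      unfolding n funpow_add o_apply using laplacian_power_symmetric[OF F D f, of m] by simp
    then show ?thesis using False laplacian_nonpositive[OF E] by simp
  qed
qed

text \<open>
  Cutting the values off outside \<open>\<Omega>\<close> turns the Dirichlet operator into an endomorphism of the functions
  supported on \<open>\<Omega>\<close>; eigenspaces, and hence eigenvalues, are unaffected.
\<close>

definition dirichlet_operator :: "'a set \<Rightarrow> nat \<Rightarrow> ('a \<Rightarrow> complex) \<Rightarrow> 'a \<Rightarrow> complex" where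
  "dirichlet_operator \<Omega> n f = zero_extension \<Omega> (\<lambda>x. (-1) ^ n * dirichlet_poly_laplace G \<Omega> n f x)"

lemma dirichlet_eigenvalue_eq:
  "dirichlet_eigenvalue G \<Omega> n k = real_eigenvalues_on \<Omega> (dirichlet_operator \<Omega> n) ! (k - 1)"
proof -
  have "eigenspace_on \<Omega> (dirichlet_operator \<Omega> n)
      = eigenspace_on \<Omega> (\<lambda>f x. (-1) ^ n * dirichlet_poly_laplace G \<Omega> n f x)"
    by (auto simp: eigenspace_on_def dirichlet_operator_def zero_extension_def fun_eq_iff)
  then show ?thesis
    by (simp add: dirichlet_eigenvalue_def real_eigenvalues_on_def)
qed

lemma dirichlet_operator_supported:
  "supported_on \<Omega> f \<Longrightarrow>
     dirichlet_operator \<Omega> n f = zero_extension \<Omega> (\<lambda>x. (-1) ^ n * (L ^^ n) f x)"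
  by (simp add: dirichlet_operator_def dirichlet_poly_laplace_def zero_extension_supported)

lemma dirichlet_operator_inner:
  assumes "finite \<Omega>" "supported_on \<Omega> f" "supported_on \<Omega> g"
  shows "l2_inner (dirichlet_operator \<Omega> n f) g = (-1) ^ n * l2_inner ((L ^^ n) f) g"
  unfolding dirichlet_operator_supported[OF assms(2)]
    l2_inner_scale_left[OF assms(1,3), symmetric]
  by (simp add: l2_inner_right[OF assms(1,3)] zero_extension_def)

lemma selfadjoint_dirichlet_operator:
  assumes "finite \<Omega>"
  shows "selfadjoint_on \<Omega> (dirichlet_operator \<Omega> n)"
proof
  fix f g :: "'a \<Rightarrow> complex" and c :: complex
  have ze: "zero_extension \<Omega> (\<lambda>x. f x + g x) = (\<lambda>x. zero_extension \<Omega> f x + zero_extension \<Omega> g x)"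
    "zero_extension \<Omega> (\<lambda>x. c * f x) = (\<lambda>x. c * zero_extension \<Omega> f x)"
    by (auto simp: zero_extension_def)
  show "dirichlet_operator \<Omega> n (\<lambda>x. f x + g x)
      = (\<lambda>x. dirichlet_operator \<Omega> n f x + dirichlet_operator \<Omega> n g x)"
    unfolding dirichlet_operator_def dirichlet_poly_laplace_def ze laplacian_power_add
    by (auto simp: zero_extension_def distrib_left)
  show "dirichlet_operator \<Omega> n (\<lambda>x. c * f x) = (\<lambda>x. c * dirichlet_operator \<Omega> n f x)"
    unfolding dirichlet_operator_def dirichlet_poly_laplace_def ze laplacian_power_scale
    by (auto simp: zero_extension_def)
  show "supported_on \<Omega> (dirichlet_operator \<Omega> n f)"
    by (simp add: dirichlet_operator_def)
  assume f: "supported_on \<Omega> f" and g: "supported_on \<Omega> g"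
  have "l2_inner f (dirichlet_operator \<Omega> n g) = cnj (l2_inner (dirichlet_operator \<Omega> n g) f)"
    by (rule l2_inner_cnj[of \<Omega>]) (simp_all add: assms dirichlet_operator_def)
  also have "\<dots> = (-1) ^ n * cnj (l2_inner ((L ^^ n) g) f)"
    by (simp add: dirichlet_operator_inner[OF assms g f])
  also have "cnj (l2_inner ((L ^^ n) g) f) = l2_inner f ((L ^^ n) g)"
    using laplacian_power_supported[OF assms g, of n] l2_inner_cnj by metis
  also have "\<dots> = l2_inner ((L ^^ n) f) g"
    by (rule laplacian_power_symmetric[OF assms f assms g, symmetric])
  finally show "l2_inner (dirichlet_operator \<Omega> n f) g = l2_inner f (dirichlet_operator \<Omega> n g)"
    by (simp add: dirichlet_operator_inner[OF assms f g])
qed (fact assms)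

lemma dirichlet_operator_nonneg:
  assumes "finite \<Omega>" "supported_on \<Omega> f"
  shows "0 \<le> Re (l2_inner (dirichlet_operator \<Omega> n f) f)"
proof -
  have "Re ((-1) ^ n * z) = (-1) ^ n * Re z" for z :: complex
    by (cases "even n") auto
  then show ?thesis
    using laplacian_power_nonneg[OF assms] by (simp add: dirichlet_operator_inner[OF assms assms(2)])
qed

text \<open>
  The left-hand side is the part over \<open>\<Omega>\<close> of the sum of \<open>|\<Delta>\<^sup>n f(x)|\<^sup>2\<close>, the right-hand side is, by
  symmetry of \<open>\<Delta>\<^sup>n\<close>, the sum over all vertices.
\<close>

lemma dirichlet_operator_compression:
  assumes \<Omega>: "finite \<Omega>" and f: "supported_on \<Omega> f"
  shows "Re (l2_inner (dirichlet_operator \<Omega> n f) (dirichlet_operator \<Omega> n f))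
      \<le> Re (l2_inner (dirichlet_operator \<Omega> (2 * n) f) f)"
    and "\<lbrakk>x \<notin> \<Omega>; (L ^^ n) f x \<noteq> 0\<rbrakk> \<Longrightarrow>
      Re (l2_inner (dirichlet_operator \<Omega> n f) (dirichlet_operator \<Omega> n f))
      < Re (l2_inner (dirichlet_operator \<Omega> (2 * n) f) f)"
proof -
  obtain E where E: "finite E" "supported_on E ((L ^^ n) f)"
    using laplacian_power_supported[OF \<Omega> f] by blast
  have E': "finite (E \<union> \<Omega>)" "supported_on (E \<union> \<Omega>) ((L ^^ n) f)"
    using E \<Omega> by (auto simp: supported_on_def)
  have "l2_inner (dirichlet_operator \<Omega> (2 * n) f) f = l2_inner ((L ^^ n) f) ((L ^^ n) f)"
    unfolding dirichlet_operator_inner[OF \<Omega> f f]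
    using laplacian_power_symmetric[OF E \<Omega> f, of n]
    by (simp add: mult_2 funpow_add power_add flip: power_mult_distrib)
  then have outer: "Re (l2_inner (dirichlet_operator \<Omega> (2 * n) f) f)
      = (\<Sum>x\<in>E \<union> \<Omega>. (cmod ((L ^^ n) f x))\<^sup>2)"
    by (simp add: l2_inner_self[OF E'])
  have inner: "Re (l2_inner (dirichlet_operator \<Omega> n f) (dirichlet_operator \<Omega> n f))
      = (\<Sum>x\<in>\<Omega>. (cmod ((L ^^ n) f x))\<^sup>2)"
    unfolding dirichlet_operator_supported[OF f] l2_inner_self[OF \<Omega> supported_on_zero_extension]
    by (simp add: zero_extension_def norm_mult norm_power)
  show "Re (l2_inner (dirichlet_operator \<Omega> n f) (dirichlet_operator \<Omega> n f))
      \<le> Re (l2_inner (dirichlet_operator \<Omega> (2 * n) f) f)"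
    unfolding outer inner using E'(1) by (intro sum_mono2) auto
  assume x: "x \<notin> \<Omega>" "(L ^^ n) f x \<noteq> 0"
  then have "x \<in> E" using E(2) by (auto simp: supported_on_def)
  with x show "Re (l2_inner (dirichlet_operator \<Omega> n f) (dirichlet_operator \<Omega> n f))
      < Re (l2_inner (dirichlet_operator \<Omega> (2 * n) f) f)"
    unfolding outer inner using E'(1) by (intro sum_strict_mono2[where b=x]) auto
qed

theorem dirichlet_eigenvalue_square_le:
  assumes "finite \<Omega>" "k \<in> {1..card \<Omega>}"
  shows "(dirichlet_eigenvalue G \<Omega> n k)\<^sup>2 \<le> dirichlet_eigenvalue G \<Omega> (2 * n) k"
  unfolding dirichlet_eigenvalue_eq using assms
  by (intro eigenvalue_square_comparison(1) selfadjoint_dirichlet_operator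
      dirichlet_operator_nonneg dirichlet_operator_compression(1)) auto

text \<open>
  If \<open>f\<close> is an eigenvector and \<open>f x = 0\<close> while \<open>\<Delta>\<^sup>n f(x) \<noteq> 0\<close>, the eigenvalue equation fails at \<open>x\<close>,
  so \<open>x\<close> lies outside \<open>\<Omega>\<close> and the restriction to \<open>\<Omega>\<close> strictly decreases the norm of \<open>\<Delta>\<^sup>n f\<close>.
\<close>

theorem dirichlet_eigenvalue_square_less:
  assumes "finite \<Omega>" "k \<in> {1..card \<Omega>}"
    and spread: "\<And>f. \<lbrakk>supported_on \<Omega> f; f \<noteq> (\<lambda>x. 0)\<rbrakk> \<Longrightarrow> \<exists>x. f x = 0 \<and> (L ^^ n) f x \<noteq> 0"
  shows "(dirichlet_eigenvalue G \<Omega> n k)\<^sup>2 < dirichlet_eigenvalue G \<Omega> (2 * n) k"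
  unfolding dirichlet_eigenvalue_eq
proof (rule eigenvalue_square_comparison(2))
  fix f m assume f: "supported_on \<Omega> f" "f \<noteq> (\<lambda>x. 0)"
    and eigen: "dirichlet_operator \<Omega> n f = (\<lambda>x. of_real m * f x)"
  obtain x where x: "f x = 0" "(L ^^ n) f x \<noteq> 0" using spread[OF f] by blast
  have "x \<notin> \<Omega>"
    using fun_cong[OF eigen, of x] x
    by (auto simp: dirichlet_operator_supported[OF f(1)] zero_extension_def)
  then show "Re (l2_inner (dirichlet_operator \<Omega> n f) (dirichlet_operator \<Omega> n f))
      < Re (l2_inner (dirichlet_operator \<Omega> (2 * n) f) f)"
    using dirichlet_operator_compression(2)[OF assms(1) f(1)] x by blast
qed (use assms in \<open>auto intro: selfadjoint_dirichlet_operator dirichlet_operator_nonneg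
    dirichlet_operator_compression(1)\<close>)

end

section \<open>Spreading of supports in the integer lattice\<close>

lemma lattice_arc_iff:
  "(x, y) \<in> parcs lattice_graph \<longleftrightarrow> (\<exists>i. y = x - axis i 1 \<or> y = x + axis i 1)"
proof -
  have "x - y = axis i 1 \<longleftrightarrow> y = x - axis i 1" "x - y = - axis i 1 \<longleftrightarrow> y = x + axis i 1" for i
    by (auto simp: algebra_simps)
  then show ?thesis by (simp add: lattice_graph_def)
qed

lemma lattice_graph_locally_finite: "locally_finite_graph (lattice_graph :: (int ^ 'd) pair_pre_digraph)"
proof
  fix x y :: "int ^ 'd"
  show "(x, y) \<in> parcs lattice_graph \<Longrightarrow> (y, x) \<in> parcs lattice_graph"
    unfolding lattice_arc_iff by force
  have "{y. (x, y) \<in> parcs lattice_graph} \<subseteq> range (\<lambda>i. x - axis i 1) \<union> range (\<lambda>i. x + axis i 1)"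
    unfolding lattice_arc_iff by blast
  then show "finite {y. (x, y) \<in> parcs lattice_graph}"
    by (rule finite_subset) simp
qed

text \<open>
  Just beyond a half-space containing the support of a function, each lattice point has a single
  neighbour in the half-space, so the Laplacian copies the values on the boundary layer one step
  outwards without cancellation.
\<close>

lemma lattice_laplacian_front:
  fixes f :: "int ^ 'd \<Rightarrow> complex" and i :: 'd
  assumes "\<And>x. x $ i > m \<Longrightarrow> f x = 0"
  shows "(\<forall>x. x $ i > m + int n \<longrightarrow> (laplacian lattice_graph ^^ n) f x = 0) \<and>
         (\<forall>x. x $ i = m \<longrightarrow> (laplacian lattice_graph ^^ n) f (x + of_nat n *s axis i 1) = f x)"
proof (induction n)
  case 0
  then show ?case using assms by simp
next
  case (Suc n)
  define g where "g = (laplacian lattice_graph ^^ n) f"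
  have far: "g x = 0" if "x $ i > m + int n" for x using Suc that by (auto simp: g_def)
  have neighbour: "y = x - axis i 1 \<or> y $ i \<ge> x $ i" if "(x, y) \<in> parcs lattice_graph" for x y
  proof -
    from that obtain j where "y = x - axis j 1 \<or> y = x + axis j 1"
      unfolding lattice_arc_iff by blast
    then show ?thesis by (cases "j = i") (auto simp: axis_def)
  qed
  have step: "laplacian lattice_graph g x = g (x - axis i 1)" if "x $ i > m + int n" for x
  proof -
    interpret locally_finite_graph "lattice_graph :: (int ^ 'd) pair_pre_digraph"
      by (rule lattice_graph_locally_finite)
    have arc: "(x, x - axis i 1) \<in> parcs lattice_graph" unfolding lattice_arc_iff by blast
    have zero: "g y = 0" if "(x, y) \<in> parcs lattice_graph" "y \<noteq> x - axis i 1" for y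
      using neighbour[OF that(1)] that(2) \<open>x $ i > m + int n\<close> by (intro far) auto
    have "laplacian lattice_graph g x = (\<Sum>y | (x, y) \<in> parcs lattice_graph. g y)"
      by (simp add: laplacian_def far[OF that])
    also have "\<dots> = (\<Sum>y\<in>{x - axis i 1}. g y)"
      using zero arc finite_neighbours[of x] by (intro sum.mono_neutral_right) auto
    finally show ?thesis by simp
  qed
  have "laplacian lattice_graph g x = 0" if "x $ i > m + int (Suc n)" for x
    using that step[of x] far[of "x - axis i 1"] by simp
  moreover have "laplacian lattice_graph g (x + of_nat (Suc n) *s axis i 1) = f x" if "x $ i = m" for x
  proof -
    have "laplacian lattice_graph g (x + of_nat (Suc n) *s axis i 1) = g (x + of_nat (Suc n) *s axis i 1 - axis i 1)"
      using that by (intro step) simp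
    also have "x + of_nat (Suc n) *s axis i 1 - axis i 1 = x + of_nat n *s axis i 1"
      by (simp add: vec_eq_iff algebra_simps)
    finally show ?thesis using Suc that by (simp add: g_def)
  qed
  ultimately show ?case by (simp add: g_def)
qed

lemma lattice_laplacian_spread:
  fixes f :: "int ^ 'd \<Rightarrow> complex"
  assumes "finite D" "supported_on D f" "f \<noteq> (\<lambda>x. 0)" "n \<ge> 1"
  shows "\<exists>x. f x = 0 \<and> (laplacian lattice_graph ^^ n) f x \<noteq> 0"
proof -
  fix i :: 'd
  let ?S = "{x. f x \<noteq> 0}"
  have "?S \<subseteq> D" using assms(2) by (auto simp: supported_on_def)
  then have S: "finite ?S" using assms(1) finite_subset by blast
  have "?S \<noteq> {}" using assms(3) by auto
  define m where "m = Max ((\<lambda>x. x $ i) ` ?S)"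
  have "m \<in> (\<lambda>x. x $ i) ` ?S" unfolding m_def using S \<open>?S \<noteq> {}\<close> by (intro Max_in) auto
  then obtain x where x: "f x \<noteq> 0" "x $ i = m" by auto
  have above: "f y = 0" if "y $ i > m" for y
  proof (rule ccontr)
    assume "f y \<noteq> 0"
    then have "y $ i \<le> m" unfolding m_def using S by (intro Max_ge) auto
    with that show False by simp
  qed
  \<comment> \<open>\<open>x\<close> is an extreme point of the support in direction \<open>i\<close>; \<open>n\<close> steps beyond it, \<open>f\<close> vanishes\<close>
  have "f (x + of_nat n *s axis i 1) = 0"
    using x assms(4) by (intro above) simp
  moreover have "(laplacian lattice_graph ^^ n) f (x + of_nat n *s axis i 1) \<noteq> 0"
    using lattice_laplacian_front[where i=i and m=m and f=f and n=n] above x by auto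
  ultimately show ?thesis by blast
qed

theorem theorem1p3:
  fixes l :: nat
  assumes "l \<ge> 1"
  shows
    "(\<forall>(G :: 'a pair_pre_digraph) \<Omega>.
        pair_bidirected_digraph G \<and> locally_finite G \<and> Digraph_Component.connected (with_proj G) \<and>
        finite \<Omega> \<and> \<Omega> \<subseteq> pverts G \<longrightarrow>
        (\<forall>k\<in>{1..card \<Omega>}.
          (dirichlet_eigenvalue G \<Omega> l k)\<^sup>2 \<le> dirichlet_eigenvalue G \<Omega> (2 * l) k)) \<and>
     (\<forall>\<Omega> :: (int ^ 'd) set.
        finite \<Omega> \<longrightarrow>
        (\<forall>k\<in>{1..card \<Omega>}.
          (dirichlet_eigenvalue lattice_graph \<Omega> l k)\<^sup>2
            < dirichlet_eigenvalue lattice_graph \<Omega> (2 * l) k))"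
proof (intro conjI allI impI ballI)
  fix G :: "'a pair_pre_digraph" and \<Omega> k
  assume G: "pair_bidirected_digraph G \<and> locally_finite G \<and> Digraph_Component.connected (with_proj G) \<and>
        finite \<Omega> \<and> \<Omega> \<subseteq> pverts G" and k: "k \<in> {1..card \<Omega>}"
  interpret pair_bidirected_digraph G using G by simp
  \<comment> \<open>the locale speaks of all points of the type; those that are no vertices have no neighbours\<close>
  interpret locally_finite_graph G
  proof
    fix x y
    show "(x, y) \<in> parcs G \<Longrightarrow> (y, x) \<in> parcs G" by (rule arcs_symmetric)
    show "finite {y. (x, y) \<in> parcs G}"
    proof (cases "x \<in> pverts G")
      case True
      then show ?thesis using G by (auto simp: locally_finite_def)
    next
      case False
      then have "{y. (x, y) \<in> parcs G} = {}" using in_arcsD1 by auto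
      then show ?thesis by simp
    qed
  qed
  show "(dirichlet_eigenvalue G \<Omega> l k)\<^sup>2 \<le> dirichlet_eigenvalue G \<Omega> (2 * l) k"
    using G k by (intro dirichlet_eigenvalue_square_le) auto
next
  fix \<Omega> :: "(int ^ 'd) set" and k
  assume "finite \<Omega>" "k \<in> {1..card \<Omega>}"
  then show "(dirichlet_eigenvalue lattice_graph \<Omega> l k)\<^sup>2 < dirichlet_eigenvalue lattice_graph \<Omega> (2 * l) k"
    using lattice_laplacian_spread assms
    by (intro locally_finite_graph.dirichlet_eigenvalue_square_less[OF lattice_graph_locally_finite])
qed

end
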